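(* Let $N$ be a positive integer. Then $${}_{8}\phi_{7}\left[\begin{matrix}q\sqrt{k},-q\sqrt{k},y,z,aq,bq,k^2q^{N}/(yz),q^{-N}\\ \sqrt{k},-\sqrt{k},qk/y,qk/z,(a+b-1)q,yzq^{1-N}/k,kq^{1+N}\end{matrix};q,q\right]$$ $$=\frac{(1-k/y)(1-k/z)(1-kq^N)(1-kq^N/(yz))}{(1-k)(1-k/(yz))(1-kq^N/y)(1-kq^N/z)}\;{}_{6}\phi_{5}\left[\begin{matrix}y,z,a,b,k^2q^{N}/(yz),q^{-N}\\ k/y,k/z,(a+b-1)q,kq^{N},yzq^{-N}/k\end{matrix};q,q^2\right].$$
   Context: For an integer $n\ge 0$, $(x;q)_n=\prod_{i=0}^{n-1}(1-xq^i)$. The basic hypergeometric series is ${}_{r+1}\phi_r\left[\begin{matrix}a_1,\dots,a_{r+1}\\ b_1,\dots,b_r\end{matrix};q,x\right]=\sum_{n\ge0}\frac{(a_1;q)_n\cdots(a_{r+1};q)_n}{(q;q)_n(b_1;q)_n\cdots(b_r;q)_n}x^n$; when $q^{-N}$ is an upper parameter the series terminates, and the sum is over $0\le n\le N$. Here $q,k,y,z$ are nonzero complex numbers and $a,b$ are complex numbers such that none of the denominators vanish; $\sqrt k$ is a fixed square root of $k$. *)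

theory Defs
  imports Complex_Main
begin

definition qpoch :: "complex \<Rightarrow> complex \<Rightarrow> nat \<Rightarrow> complex" where
  "qpoch x q n = (\<Prod>i<n. 1 - x * q ^ i)"

definition bhs_denom :: "complex list \<Rightarrow> complex \<Rightarrow> nat \<Rightarrow> complex" where
  "bhs_denom bs q n = qpoch q q n * prod_list (map (\<lambda>b. qpoch b q n) bs)"

definition bhs_term :: "complex list \<Rightarrow> complex list \<Rightarrow> complex \<Rightarrow> complex \<Rightarrow> nat \<Rightarrow> complex" where
  "bhs_term as bs q x n = prod_list (map (\<lambda>a. qpoch a q n) as) / bhs_denom bs q n * x ^ n"

text \<open>
  The basic hypergeometric series with upper parameters \<open>as\<close> and lower parameters \<open>bs\<close>,
  meant for \<open>length as = length bs + 1\<close>. If some upper parameter is \<open>q\<close> to the power \<open>-N\<close>,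
  the numerators vanish for \<open>n > N\<close>, so (with \<open>0 / 0 = 0\<close>) only the denominators with
  \<open>n \<le> N\<close> matter; see \<open>bhs_terminating\<close> below.
\<close>
definition bhs :: "complex list \<Rightarrow> complex list \<Rightarrow> complex \<Rightarrow> complex \<Rightarrow> complex" where
  "bhs as bs q x = (\<Sum>n. bhs_term as bs q x n)"

lemma qpoch_terminating:
  assumes "q \<noteq> 0" "N < n"
  shows "qpoch (q powi (- int N)) q n = 0"
  unfolding qpoch_def using assms
  by (intro prod_zero) (auto intro!: bexI[of _ N] simp: power_int_minus)

lemma bhs_terminating:
  assumes "q \<noteq> 0" "q powi (- int N) \<in> set as"
  shows "bhs as bs q x = (\<Sum>n\<le>N. bhs_term as bs q x n)"
  unfolding bhs_def
proof (rule suminf_finite)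
  fix n assume "n \<notin> {..N}"
  then have "qpoch (q powi (- int N)) q n = 0"
    using assms by (intro qpoch_terminating) auto
  then have "0 \<in> set (map (\<lambda>a. qpoch a q n) as)"
    using assms(2) by (force simp: image_iff)
  then show "bhs_term as bs q x n = 0"
    unfolding bhs_term_def by (simp add: prod_list_zero_iff)
qed simp

end

theory Submission
  imports Defs
begin

text \<open>
  Write \<open>d = k\<^sup>2 q\<^sup>N / (y z)\<close> and \<open>e = q\<^sup>-\<^sup>N\<close>, so that \<open>y z d e = k\<^sup>2\<close>. Two telescoping facts give the
  theorem by summation by parts. First, \<open>u\<^sub>n = (aq)\<^sub>n (bq)\<^sub>n / ((q)\<^sub>n ((a+b-1)q)\<^sub>n)\<close> is the \<open>n\<close>-th
  partial sum of \<open>(a)\<^sub>j (b)\<^sub>j q\<^sup>2\<^sup>j / ((q)\<^sub>j ((a+b-1)q)\<^sub>j)\<close>. Second, the remaining factor of the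
  \<open>n\<close>-th term on the left is a constant multiple of \<open>W\<^sub>n - W\<^sub>n\<^sub>+\<^sub>1\<close>, where
  \<open>W\<^sub>n = (y)\<^sub>n (z)\<^sub>n (d)\<^sub>n (e)\<^sub>n / ((k/y)\<^sub>n (k/z)\<^sub>n (k/d)\<^sub>n (k/e)\<^sub>n)\<close>, and \<open>W\<^sub>N\<^sub>+\<^sub>1 = 0\<close>.
\<close>

lemma qpoch_0 [simp]: "qpoch x q 0 = 1"
  by (simp add: qpoch_def)

lemma qpoch_Suc: "qpoch x q (Suc n) = qpoch x q n * (1 - x * q ^ n)"
  by (simp add: qpoch_def mult.commute)

text \<open>Both sides are the full product \<open>qpoch x q (Suc n)\<close>, with its first or its
  last factor split off.\<close>

lemma qpoch_shift: "(1 - x) * qpoch (q * x) q n = qpoch x q n * (1 - x * q ^ n)"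
proof (induction n)
  case (Suc n)
  have "(1 - x) * qpoch (q * x) q (Suc n) = (1 - x) * qpoch (q * x) q n * (1 - x * q ^ Suc n)"
    by (simp add: qpoch_Suc mult_ac)
  then show ?case
    unfolding Suc.IH qpoch_Suc .
qed simp

lemma qpoch_shift_div:
  assumes "x \<noteq> 1"
  shows "qpoch (q * x) q n = qpoch x q n * (1 - x * q ^ n) / (1 - x)"
  using qpoch_shift[of x q n] assms by (simp add: field_simps)

text \<open>Shifting the base by \<open>q\<close> multiplies \<open>qpoch s q n\<close> by
  \<open>(1 - s * q ^ n) / (1 - s)\<close>. The factors for \<open>s\<close> and \<open>- s\<close>
  pair up as differences of squares, so only \<open>s ^ 2\<close> remains.\<close>

lemma qpoch_very_well_poised:
  assumes "s ^ 2 \<noteq> 1" "qpoch s q n \<noteq> 0" "qpoch (- s) q n \<noteq> 0"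
  shows "qpoch (q * s) q n * qpoch (- q * s) q n / (qpoch s q n * qpoch (- s) q n)
       = (1 - s ^ 2 * q ^ (2 * n)) / (1 - s ^ 2)"
proof -
  have s: "s \<noteq> 1" "- s \<noteq> 1"
    using assms(1) by (auto simp: minus_equation_iff)
  have e: "(1 - s) * (1 - - s) = 1 - s ^ 2"
    "(1 - s * q ^ n) * (1 - - s * q ^ n) = 1 - s ^ 2 * q ^ (2 * n)"
    by (simp_all add: algebra_simps power2_eq_square power_mult power_mult_distrib)
  have "qpoch (q * s) q n * qpoch (- q * s) q n / (qpoch s q n * qpoch (- s) q n)
      = ((1 - s * q ^ n) * (1 - - s * q ^ n)) / ((1 - s) * (1 - - s))"
    using qpoch_shift_div[OF s(1), of q n] qpoch_shift_div[OF s(2), of q n] assms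
    by simp
  then show ?thesis
    by (simp only: e)
qed

text \<open>Induction on \<open>n\<close>: with common factors removed, appending the summand
  \<open>j = n + 1\<close> becomes the quadratic identity \<open>key\<close> in
  \<open>x = q ^ (n + 1)\<close>.\<close>

lemma sum_qpoch_quotient:
  assumes "qpoch q q n \<noteq> 0" "qpoch ((a + b - 1) * q) q n \<noteq> 0"
  shows "(\<Sum>j\<le>n. qpoch a q j * qpoch b q j / (qpoch q q j * qpoch ((a + b - 1) * q) q j) * (q ^ 2) ^ j)
       = qpoch (a * q) q n * qpoch (b * q) q n / (qpoch q q n * qpoch ((a + b - 1) * q) q n)"
  using assms
proof (induction n)
  case (Suc n)
  define x c A B Q C where "x = q ^ Suc n" and "c = a + b - 1"
    and "A = qpoch (a * q) q n" and "B = qpoch (b * q) q n"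
    and "Q = qpoch q q n" and "C = qpoch (c * q) q n"
  \<comment> \<open>Splitting off the first factor instead of the last leaves \<open>A\<close> and
    \<open>B\<close>, the products in the closed form.\<close>
  have a: "qpoch a q (Suc n) = (1 - a) * A" and b: "qpoch b q (Suc n) = (1 - b) * B"
    using qpoch_shift[of a q n] qpoch_shift[of b q n]
    by (simp_all add: qpoch_Suc A_def B_def mult.commute)
  have Suc': "qpoch (a * q) q (Suc n) = A * (1 - a * x)" "qpoch (b * q) q (Suc n) = B * (1 - b * x)"
    "qpoch q q (Suc n) = Q * (1 - x)" "qpoch (c * q) q (Suc n) = C * (1 - c * x)"
    by (simp_all add: qpoch_Suc A_def B_def Q_def C_def x_def mult.assoc)
  have x2: "(q ^ 2) ^ Suc n = x ^ 2"
    by (simp add: x_def power_mult_distrib power2_eq_square)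
  have nz: "Q \<noteq> 0" "1 - x \<noteq> 0" "C \<noteq> 0" "1 - c * x \<noteq> 0"
    using Suc.prems unfolding c_def[symmetric] Suc' by auto
  \<comment> \<open>The linear coefficients agree because \<open>1 + c = a + b\<close>, which
    dictates the lower parameter \<open>c * q\<close>; \<open>x ^ 2\<close> comes from the argument
    \<open>q ^ 2\<close>.\<close>
  have key: "(1 - x) * (1 - c * x) + (1 - a) * (1 - b) * x ^ 2 = (1 - a * x) * (1 - b * x)"
    by (simp add: c_def algebra_simps power2_eq_square)
  have "A * B / (Q * C) + (1 - a) * A * ((1 - b) * B) / (Q * (1 - x) * (C * (1 - c * x))) * x ^ 2
      = A * B * ((1 - x) * (1 - c * x) + (1 - a) * (1 - b) * x ^ 2) / (Q * (1 - x) * (C * (1 - c * x)))"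
    using nz by (simp add: divide_simps) (simp add: algebra_simps)
  also have "\<dots> = A * (1 - a * x) * (B * (1 - b * x)) / (Q * (1 - x) * (C * (1 - c * x)))"
    unfolding key by (simp only: mult_ac)
  finally have step: "A * B / (Q * C)
      + (1 - a) * A * ((1 - b) * B) / (Q * (1 - x) * (C * (1 - c * x))) * x ^ 2
      = A * (1 - a * x) * (B * (1 - b * x)) / (Q * (1 - x) * (C * (1 - c * x)))" .
  have IH: "(\<Sum>j\<le>n. qpoch a q j * qpoch b q j / (qpoch q q j * qpoch (c * q) q j) * (q ^ 2) ^ j)
      = A * B / (Q * C)"
    using Suc.IH nz by (simp add: A_def B_def Q_def C_def c_def)
  show ?case
    unfolding c_def[symmetric] sum.atMost_Suc IH a b Suc' x2 by (rule step)
qed simp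

text \<open>Abel summation; the boundary term at \<open>Suc N\<close> vanishes in the
  application.\<close>

lemma sum_by_parts:
  fixes W g :: "nat \<Rightarrow> 'a::comm_ring"
  shows "(\<Sum>n\<le>N. (W n - W (Suc n)) * (\<Sum>j\<le>n. g j))
       = (\<Sum>n\<le>N. W n * g n) - W (Suc N) * (\<Sum>j\<le>N. g j)"
  by (induction N) (simp_all add: algebra_simps)

text \<open>The coefficients are elementary symmetric functions of \<open>y, z, d, e\<close> and of
  their partners \<open>k / y, k / z, k / d, k / e\<close>. As the product is \<open>k ^ 2\<close>,
  the second and fourth agree, and the third of either set is \<open>k\<close> times the first of
  the other. Only \<open>x\<close> and \<open>x ^ 3\<close> survive, the latter with
  \<open>- k\<close> times the coefficient of the former.\<close>

lemma well_poised_product_diff: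
  fixes k y z d e x :: "'a::field"
  assumes "y \<noteq> 0" "z \<noteq> 0" "d \<noteq> 0" "e \<noteq> 0" "y * z * d * e = k ^ 2"
  shows "(1 - k / y * x) * (1 - k / z * x) * (1 - k / d * x) * (1 - k / e * x)
         - (1 - y * x) * (1 - z * x) * (1 - d * x) * (1 - e * x)
       = x * (1 - k * x ^ 2) * (y + z + d + e - (k / y + k / z + k / d + k / e))"
proof -
  define Y Z D E where "Y = k / y" and "Z = k / z" and "D = k / d" and "E = k / e"
  have k2: "k * k = y * (z * (d * e))"
    using assms(5) by (simp add: power2_eq_square mult_ac)
  have e2: "D * E = y * z" "Z * E = y * d" "Z * D = y * e" "Y * E = z * d" "Y * D = z * e" "Y * Z = d * e"
    using assms(1-4) k2 by (auto simp: Y_def Z_def D_def E_def divide_simps mult_ac)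
  have e1: "y * Y = k" "z * Z = k" "d * D = k" "e * E = k"
    using assms(1-4) by (auto simp: Y_def Z_def D_def E_def)
  have P: "(1 - Y * x) * (1 - Z * x) * (1 - D * x) * (1 - E * x)
    = 1 - (Y + Z + D + E) * x + (Y * Z + Y * D + Y * E + Z * D + Z * E + D * E) * x ^ 2
      - ((Y * Z) * D + (Y * Z) * E + Y * (D * E) + Z * (D * E)) * x ^ 3 + (Y * Z) * (D * E) * x ^ 4"
    by (simp add: algebra_simps power2_eq_square power3_eq_cube power4_eq_xxxx)
  have e3: "(Y * Z) * D = k * e" "(Y * Z) * E = k * d" "Y * (D * E) = k * z" "Z * (D * E) = k * y"
    unfolding e2 using e1 by (auto simp: mult_ac)
  \<comment> \<open>Trading one pair by \<open>e2\<close> puts a parameter next to its own partner,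
    and their product is \<open>k\<close>.\<close>
  have "y * z * d = (D * E) * d" "y * z * e = (D * E) * e" "y * d * e = (Z * E) * e" "z * d * e = (Y * E) * e"
    by (simp_all only: e2)
  moreover have "(D * E) * d = (d * D) * E" "(D * E) * e = (e * E) * D" "(Z * E) * e = (e * E) * Z"
    "(Y * E) * e = (e * E) * Y"
    by (simp_all only: mult_ac)
  ultimately have e3': "y * z * d = k * E" "y * z * e = k * D" "y * d * e = k * Z" "z * d * e = k * Y"
    by (simp_all only: e1)
  have "(1 - y * x) * (1 - z * x) * (1 - d * x) * (1 - e * x)
    = 1 - (y + z + d + e) * x + (d * e + z * e + z * d + y * e + y * d + y * z) * x ^ 2
      - (y * z * d + y * z * e + y * d * e + z * d * e) * x ^ 3 + (d * e) * (y * z) * x ^ 4"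
    by (simp add: algebra_simps power2_eq_square power3_eq_cube power4_eq_xxxx)
  then have p: "(1 - y * x) * (1 - z * x) * (1 - d * x) * (1 - e * x)
    = 1 - (y + z + d + e) * x + (d * e + z * e + z * d + y * e + y * d + y * z) * x ^ 2
      - (k * E + k * D + k * Z + k * Y) * x ^ 3 + (d * e) * (y * z) * x ^ 4"
    unfolding e3' .
  show ?thesis
    \<comment> \<open>\<open>e3\<close> must precede \<open>e2\<close>, which would rewrite the
      pairs inside its left-hand sides.\<close>
    unfolding Y_def[symmetric] Z_def[symmetric] D_def[symmetric] E_def[symmetric] P p unfolding e3 unfolding e2
    by (simp add: algebra_simps power2_eq_square power3_eq_cube)
qed

text \<open>Eliminating \<open>d\<close> by the product condition leaves an identity of rational
  functions. The factored form decides when the telescoping constant is nonzero and yields the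
  denominator of the final prefactor, apart from \<open>1 - k\<close>.\<close>

lemma well_poised_sum_factor:
  fixes k y z d e :: "'a::field"
  assumes "y \<noteq> 0" "z \<noteq> 0" "d \<noteq> 0" "e \<noteq> 0" "k \<noteq> 0" "y * z * d * e = k ^ 2"
  shows "y + z + d + e - (k / y + k / z + k / d + k / e)
       = - (y * z * e / k) * (1 - k / (y * z)) * (1 - k / (e * y)) * (1 - k / (e * z))"
proof -
  have d: "d = k ^ 2 / (y * z * e)"
    using assms by (simp add: nonzero_eq_divide_eq mult_ac)
  then have kd: "k / d = y * z * e / k"
    using assms by (simp add: power2_eq_square)
  show ?thesis
    unfolding kd unfolding d
    using assms(1,2,4,5) by (simp add: divide_simps) (simp add: algebra_simps power2_eq_square)
qed

text \<open>Over a common denominator, the difference of consecutive \<open>W\<close> is evaluated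
  by \<open>well_poised_product_diff\<close> at \<open>x = q ^ n\<close>. Replacing
  \<open>k / y\<close> by \<open>q * (k / y)\<close>, and likewise for the other partners, produces
  the constant on the right.\<close>

lemma well_poised_telescope:
  fixes k y z d e q :: complex
  defines "W \<equiv> \<lambda>n. qpoch y q n * qpoch z q n * qpoch d q n * qpoch e q n
    / (qpoch (k / y) q n * qpoch (k / z) q n * qpoch (k / d) q n * qpoch (k / e) q n)"
  assumes nz: "y \<noteq> 0" "z \<noteq> 0" "d \<noteq> 0" "e \<noteq> 0" and k2: "y * z * d * e = k ^ 2"
    and ne1: "k / y \<noteq> 1" "k / z \<noteq> 1" "k / d \<noteq> 1" "k / e \<noteq> 1"
    and den: "qpoch (q * (k / y)) q n \<noteq> 0" "qpoch (q * (k / z)) q n \<noteq> 0"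
      "qpoch (q * (k / d)) q n \<noteq> 0" "qpoch (q * (k / e)) q n \<noteq> 0"
  shows "(y + z + d + e - (k / y + k / z + k / d + k / e)) * ((1 - k * q ^ (2 * n)) * q ^ n
      * (qpoch y q n * qpoch z q n * qpoch d q n * qpoch e q n
        / (qpoch (q * (k / y)) q n * qpoch (q * (k / z)) q n
           * qpoch (q * (k / d)) q n * qpoch (q * (k / e)) q n)))
    = (1 - k / y) * (1 - k / z) * (1 - k / d) * (1 - k / e) * (W n - W (Suc n))"
proof -
  define x s where "x = q ^ n" and "s = y + z + d + e - (k / y + k / z + k / d + k / e)"
  define M D where "M = qpoch y q n * qpoch z q n * qpoch d q n * qpoch e q n"
    and "D = qpoch (k / y) q n * qpoch (k / z) q n * qpoch (k / d) q n * qpoch (k / e) q n"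
  define m \<Delta> \<Pi> where "m = (1 - y * x) * (1 - z * x) * (1 - d * x) * (1 - e * x)"
    and "\<Delta> = (1 - k / y * x) * (1 - k / z * x) * (1 - k / d * x) * (1 - k / e * x)"
    and "\<Pi> = (1 - k / y) * (1 - k / z) * (1 - k / d) * (1 - k / e)"
  define D1 where "D1 = qpoch (q * (k / y)) q n * qpoch (q * (k / z)) q n
           * qpoch (q * (k / d)) q n * qpoch (q * (k / e)) q n"
  have D1: "\<Pi> * D1 = D * \<Delta>"
  proof -
    have "\<Pi> * D1 = ((1 - k / y) * qpoch (q * (k / y)) q n) * ((1 - k / z) * qpoch (q * (k / z)) q n)
       * ((1 - k / d) * qpoch (q * (k / d)) q n) * ((1 - k / e) * qpoch (q * (k / e)) q n)"
      by (simp only: \<Pi>_def D1_def mult_ac)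
    also have "\<dots> = D * \<Delta>"
      unfolding qpoch_shift D_def \<Delta>_def x_def[symmetric] by (simp only: mult_ac)
    finally show ?thesis .
  qed
  have Pi: "\<Pi> \<noteq> 0" and "D1 \<noteq> 0"
    using ne1 den by (auto simp: \<Pi>_def D1_def)
  \<comment> \<open>\<open>den\<close> concerns the shifted products; the identity \<open>D1\<close>
    transfers nonvanishing to the denominators of \<open>W n\<close> and
    \<open>W (Suc n)\<close>.\<close>
  then have D: "D \<noteq> 0" "\<Delta> \<noteq> 0"
    using D1 by auto
  have W: "W n = M / D" "W (Suc n) = (M * m) / (D * \<Delta>)"
    by (simp_all only: W_def M_def D_def m_def \<Delta>_def qpoch_Suc x_def mult_ac)
  have diff: "\<Delta> - m = x * (1 - k * x ^ 2) * s"
    unfolding m_def \<Delta>_def s_def by (rule well_poised_product_diff[OF nz k2])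
  have x2: "q ^ (2 * n) = x ^ 2"
    by (simp add: x_def mult.commute flip: power_mult)
  have "D1 = D * \<Delta> / \<Pi>"
    using D1 Pi by (simp add: field_simps)
  then have "s * ((1 - k * x ^ 2) * x * (M / D1)) = \<Pi> * (M * (x * (1 - k * x ^ 2) * s) / (D * \<Delta>))"
    by simp
  also have "\<dots> = \<Pi> * (M / D - (M * m) / (D * \<Delta>))"
    unfolding diff[symmetric] using D by (simp add: field_simps)
  finally show ?thesis
    unfolding W x2 x_def[symmetric] s_def[symmetric] M_def[symmetric] D1_def[symmetric] \<Pi>_def[symmetric] .
qed

theorem corollary5:
  fixes q k sqrt_k y z a b :: complex and N :: nat
  assumes "N > 0"
    and "q \<noteq> 0" "k \<noteq> 0" "y \<noteq> 0" "z \<noteq> 0"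
    and sqrt_k: "sqrt_k ^ 2 = k"
    and denom_lhs: "\<forall>n\<le>N. bhs_denom
          [sqrt_k, - sqrt_k, q * k / y, q * k / z, (a + b - 1) * q,
           y * z * q powi (1 - int N) / k, k * q ^ (1 + N)] q n \<noteq> 0"
    and denom_rhs: "\<forall>n\<le>N. bhs_denom
          [k / y, k / z, (a + b - 1) * q, k * q ^ N, y * z * q powi (- int N) / k] q n \<noteq> 0"
    and denom_factor:
      "(1 - k) * (1 - k / (y * z)) * (1 - k * q ^ N / y) * (1 - k * q ^ N / z) \<noteq> 0"
  shows "bhs
          [q * sqrt_k, - q * sqrt_k, y, z, a * q, b * q, k ^ 2 * q ^ N / (y * z), q powi (- int N)]
          [sqrt_k, - sqrt_k, q * k / y, q * k / z, (a + b - 1) * q,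
           y * z * q powi (1 - int N) / k, k * q ^ (1 + N)] q q
       = ((1 - k / y) * (1 - k / z) * (1 - k * q ^ N) * (1 - k * q ^ N / (y * z)))
         / ((1 - k) * (1 - k / (y * z)) * (1 - k * q ^ N / y) * (1 - k * q ^ N / z))
         * bhs
          [y, z, a, b, k ^ 2 * q ^ N / (y * z), q powi (- int N)]
          [k / y, k / z, (a + b - 1) * q, k * q ^ N, y * z * q powi (- int N) / k] q (q ^ 2)"
proof -
  define e d where "e = q powi (- int N)" and "d = k ^ 2 * q ^ N / (y * z)"
  have e: "e = 1 / q ^ N"
    by (simp add: e_def power_int_minus field_simps)
  have nz: "y \<noteq> 0" "z \<noteq> 0" "d \<noteq> 0" "e \<noteq> 0" "k \<noteq> 0"
    using assms by (auto simp: d_def e)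
  have k2: "y * z * d * e = k ^ 2"
    using assms(2-5) by (simp add: d_def e)
  \<comment> \<open>This exposes the well-poised pairing: the partners of \<open>y, z, d, e\<close>
    are lower parameters on the right, and \<open>q\<close> times them on the left.\<close>
  have low: "q * k / y = q * (k / y)" "q * k / z = q * (k / z)" "k * q ^ N = k / e"
    "y * z * e / k = k / d" "k * q ^ (1 + N) = q * (k / e)"
    "y * z * q powi (1 - int N) / k = q * (k / d)"
    using assms(2-5) by (simp_all add: d_def e power_int_diff power2_eq_square field_simps)
  define c W A g s where "c = a + b - 1"
    and "W = (\<lambda>n. qpoch y q n * qpoch z q n * qpoch d q n * qpoch e q n
      / (qpoch (k / y) q n * qpoch (k / z) q n * qpoch (k / d) q n * qpoch (k / e) q n))"
    and "A = (\<lambda>n. (1 - k * q ^ (2 * n)) * q ^ n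
      * (qpoch y q n * qpoch z q n * qpoch d q n * qpoch e q n
        / (qpoch (q * (k / y)) q n * qpoch (q * (k / z)) q n
           * qpoch (q * (k / d)) q n * qpoch (q * (k / e)) q n)))"
    and "g = (\<lambda>j. qpoch a q j * qpoch b q j / (qpoch q q j * qpoch (c * q) q j) * (q ^ 2) ^ j)"
    and "s = y + z + d + e - (k / y + k / z + k / d + k / e)"
  define \<Pi> where "\<Pi> = (1 - k / y) * (1 - k / z) * (1 - k / d) * (1 - k / e)"
  have L: "qpoch q q n \<noteq> 0" "qpoch sqrt_k q n \<noteq> 0" "qpoch (- sqrt_k) q n \<noteq> 0"
    "qpoch (q * (k / y)) q n \<noteq> 0" "qpoch (q * (k / z)) q n \<noteq> 0"
    "qpoch (c * q) q n \<noteq> 0" "qpoch (q * (k / d)) q n \<noteq> 0" "qpoch (q * (k / e)) q n \<noteq> 0"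
    if "n \<le> N" for n
    using denom_lhs[rule_format, OF that] unfolding low c_def by (simp_all add: bhs_denom_def)
  \<comment> \<open>At index 1 each denominator factor is just \<open>1 - k / y\<close> and the
    like; this index is in range because \<open>N > 0\<close>.\<close>
  have ne1: "k / y \<noteq> 1" "k / z \<noteq> 1" "k / d \<noteq> 1" "k / e \<noteq> 1"
    using denom_rhs[rule_format, of 1] \<open>N > 0\<close> unfolding low e_def[symmetric]
    by (auto simp: bhs_denom_def qpoch_def)
  have k1: "k \<noteq> 1"
    using denom_factor by auto
  have lhs: "bhs
          [q * sqrt_k, - q * sqrt_k, y, z, a * q, b * q, d, e]
          [sqrt_k, - sqrt_k, q * (k / y), q * (k / z), c * q, q * (k / d), q * (k / e)] q q
        = (\<Sum>n\<le>N. A n * (\<Sum>j\<le>n. g j)) / (1 - k)"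
    unfolding sum_divide_distrib
  proof (subst bhs_terminating[of q N], goal_cases)
    case 3
    show ?case
    proof (rule sum.cong[OF refl])
      fix n assume "n \<in> {..N}"
      then have n: "n \<le> N" by simp
      note Ln = L[OF n]
      have "bhs_term
          [q * sqrt_k, - q * sqrt_k, y, z, a * q, b * q, d, e]
          [sqrt_k, - sqrt_k, q * (k / y), q * (k / z), c * q, q * (k / d), q * (k / e)] q q n
        = (qpoch (q * sqrt_k) q n * qpoch (- q * sqrt_k) q n
            / (qpoch sqrt_k q n * qpoch (- sqrt_k) q n)) * q ^ n
          * (qpoch y q n * qpoch z q n * qpoch d q n * qpoch e q n
            / (qpoch (q * (k / y)) q n * qpoch (q * (k / z)) q n
               * qpoch (q * (k / d)) q n * qpoch (q * (k / e)) q n))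
          * (qpoch (a * q) q n * qpoch (b * q) q n / (qpoch q q n * qpoch (c * q) q n))"
        by (simp add: bhs_term_def bhs_denom_def mult_ac)
      \<comment> \<open>The very-well-poised quotient, with \<open>sqrt_k ^ 2 = k\<close>, gives
        \<open>(1 - k * q ^ (2 * n)) / (1 - k)\<close>; the quotient in \<open>a, b\<close> is a
        partial sum of \<open>g\<close>.\<close>
      also have "\<dots> = A n * (\<Sum>j\<le>n. g j) / (1 - k)"
        using qpoch_very_well_poised[of sqrt_k q n] sum_qpoch_quotient[of q n a b] Ln k1 sqrt_k
        by (simp add: A_def g_def c_def)
      finally show "bhs_term
          [q * sqrt_k, - q * sqrt_k, y, z, a * q, b * q, d, e]
          [sqrt_k, - sqrt_k, q * (k / y), q * (k / z), c * q, q * (k / d), q * (k / e)] q q n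
        = A n * (\<Sum>j\<le>n. g j) / (1 - k)" .
    qed
  qed (use \<open>q \<noteq> 0\<close> in \<open>simp_all add: e_def\<close>)
  have rhs: "bhs [y, z, a, b, d, e] [k / y, k / z, c * q, k / e, k / d] q (q ^ 2)
      = (\<Sum>n\<le>N. W n * g n)"
    using \<open>q \<noteq> 0\<close>
    by (subst bhs_terminating[of q N])
       (simp_all add: e_def[symmetric] bhs_term_def bhs_denom_def W_def g_def mult_ac)
  have "s * (\<Sum>n\<le>N. A n * (\<Sum>j\<le>n. g j)) = (\<Sum>n\<le>N. (s * A n) * (\<Sum>j\<le>n. g j))"
    by (simp add: sum_distrib_left mult.assoc)
  also have "\<dots> = (\<Sum>n\<le>N. \<Pi> * (W n - W (Suc n)) * (\<Sum>j\<le>n. g j))"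
  proof (rule sum.cong[OF refl])
    fix n assume "n \<in> {..N}"
    then have "s * A n = \<Pi> * (W n - W (Suc n))"
      unfolding s_def A_def \<Pi>_def W_def
      by (intro well_poised_telescope nz k2 ne1 L) simp_all
    then show "s * A n * (\<Sum>j\<le>n. g j) = \<Pi> * (W n - W (Suc n)) * (\<Sum>j\<le>n. g j)"
      by simp
  qed
  also have "\<dots> = \<Pi> * (\<Sum>n\<le>N. (W n - W (Suc n)) * (\<Sum>j\<le>n. g j))"
    by (simp add: sum_distrib_left mult.assoc)
  \<comment> \<open>The numerator of \<open>W (Suc N)\<close> contains
    \<open>qpoch e q (Suc N)\<close>, which is zero since \<open>e * q ^ N = 1\<close>.\<close>
  also have "\<dots> = \<Pi> * (\<Sum>n\<le>N. W n * g n)"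
    using qpoch_terminating[OF \<open>q \<noteq> 0\<close>, of N "Suc N"] unfolding sum_by_parts
    by (simp add: W_def e_def)
  finally have key: "s * (\<Sum>n\<le>N. A n * (\<Sum>j\<le>n. g j)) = \<Pi> * (\<Sum>n\<le>N. W n * g n)" .
  have qN: "k * q ^ N / y = k / (e * y)" "k * q ^ N / z = k / (e * z)" "k * q ^ N / (y * z) = d / k"
    using nz by (simp_all add: e d_def power2_eq_square)
  have s: "s = - (k / d) * (1 - k / (y * z)) * (1 - k / (e * y)) * (1 - k / (e * z))"
    using well_poised_sum_factor[OF nz k2] unfolding s_def low(4) .
  then have "s \<noteq> 0"
    using denom_factor nz unfolding qN by simp
  \<comment> \<open>\<open>\<Pi>\<close> contains \<open>1 - k / d\<close>, but the prefactor needs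
    \<open>1 - d / k\<close>; the extracted \<open>- (k / d)\<close> cancels the same factor of
    \<open>s\<close>.\<close>
  have kd: "1 - k / d = - (k / d) * (1 - d / k)"
    using nz by (simp add: field_simps)
  have "\<Pi> / ((1 - k) * s) = - (k / d) * ((1 - k / y) * (1 - k / z) * (1 - k / e) * (1 - d / k))
      / (- (k / d) * ((1 - k) * (1 - k / (y * z)) * (1 - k / (e * y)) * (1 - k / (e * z))))"
    unfolding \<Pi>_def s kd by (simp only: mult_ac)
  also have "\<dots> = ((1 - k / y) * (1 - k / z) * (1 - k / e) * (1 - d / k))
      / ((1 - k) * (1 - k / (y * z)) * (1 - k / (e * y)) * (1 - k / (e * z)))"
    using nz by (intro mult_divide_mult_cancel_left) simp
  finally have P: "\<Pi> / ((1 - k) * s)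
    = ((1 - k / y) * (1 - k / z) * (1 - k / e) * (1 - d / k))
      / ((1 - k) * (1 - k / (y * z)) * (1 - k / (e * y)) * (1 - k / (e * z)))" .
  have "(\<Sum>n\<le>N. A n * (\<Sum>j\<le>n. g j)) / (1 - k) = \<Pi> / ((1 - k) * s) * (\<Sum>n\<le>N. W n * g n)"
    using key \<open>s \<noteq> 0\<close> k1 by (simp add: field_simps)
  then show ?thesis
    unfolding e_def[symmetric] d_def[symmetric] c_def[symmetric] qN unfolding low lhs rhs P .
qed

end
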